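(* Let $\beta>0$, $M>0$, let $W\in L^\infty(\mathbb T^d)$ be even, and let $$\operatorname{ess\,osc}_{\mathbb T^d}W:=\operatorname*{ess\,sup}_{\mathbb T^d}W-\operatorname*{ess\,inf}_{\mathbb T^d}W .$$ If $$M\,\beta\,\operatorname{ess\,osc}_{\mathbb T^d}W<1,$$ then the constant density $\varrho_0:=M/|\mathbb T^d|$ is the unique global minimizer of $\mathcal F_\beta$ among nonnegative densities of mass $M$.
   Context: $\mathbb T^d=\mathbb R^d/\mathbb Z^d$; $W\ast\varrho$ is the periodic convolution. The free energy is $$\mathcal F_\beta(\varrho)=\int_{\mathbb T^d}\varrho(\log\varrho-1)\,\mathrm dx-\beta\int_{\mathbb T^d}\varrho\,(W\ast\varrho)\,\mathrm dx ,$$ with $0\log0=0$. Nonnegative densities of mass $M$ are the elements of $$\mathcal A_M=\left\{\varrho\in L^1(\mathbb T^d):\ \varrho\ge0,\ \int_{\mathbb T^d}\varrho\,\mathrm dx=M,\ \int_{\mathbb T^d}\varrho\log\varrho\,\mathrm dx<+\infty\right\}$$ (densities with infinite entropy have $\mathcal F_\beta=+\infty$). *)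

theory Defs
  imports "HOL-Probability.Essential_Supremum"
begin

section \<open>The flat torus\<close>

definition int_equiv :: "real ^ 'n \<Rightarrow> real ^ 'n \<Rightarrow> bool" where
  "int_equiv x y \<longleftrightarrow> (\<forall>i. x $ i - y $ i \<in> \<int>)"

lemma equivp_int_equiv: "equivp int_equiv"
proof (rule equivpI)
  show "reflp int_equiv"
    by (simp add: reflp_def int_equiv_def)
  show "symp int_equiv"
    by (auto simp: symp_def int_equiv_def intro: minus_in_Ints_iff[THEN iffD1])
  show "transp int_equiv"
  proof (rule transpI, unfold int_equiv_def, rule allI)
    fix x y z :: "real ^ 'n" and i
    assume "\<forall>i. x $ i - y $ i \<in> \<int>" "\<forall>i. y $ i - z $ i \<in> \<int>"
    then have "(x $ i - y $ i) + (y $ i - z $ i) \<in> \<int>"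
      by (intro Ints_add) auto
    then show "x $ i - z $ i \<in> \<int>" by simp
  qed
qed

quotient_type 'n torus = "real ^ ('n::finite)" / int_equiv
  morphisms rep_torus to_torus
  by (rule equivp_int_equiv)

instantiation torus :: (finite) ab_group_add
begin

lift_definition zero_torus :: "'a torus" is 0 .

lift_definition plus_torus :: "'a torus \<Rightarrow> 'a torus \<Rightarrow> 'a torus" is "(+)"
  unfolding int_equiv_def vector_add_component add_diff_add by (blast intro: Ints_add)

lift_definition uminus_torus :: "'a torus \<Rightarrow> 'a torus" is uminus
  unfolding int_equiv_def vector_uminus_component minus_diff_minus by (blast intro: Ints_minus)

lift_definition minus_torus :: "'a torus \<Rightarrow> 'a torus \<Rightarrow> 'a torus" is "(-)"
  unfolding int_equiv_def vector_minus_component diff_diff_eq2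
  by (metis (no_types, lifting) Ints_diff add_diff_eq diff_diff_eq2 diff_add_eq)

instance
  by standard (transfer; simp add: int_equiv_def)+

end

instantiation torus :: (finite) topological_space
begin

text \<open>The quotient topology.\<close>
definition open_torus :: "'a torus set \<Rightarrow> bool" where
  "open_torus U \<longleftrightarrow> open (to_torus -` U)"

instance
  by standard (auto simp: open_torus_def vimage_Union intro: open_UN)

end

definition unit_cube :: "(real ^ 'n::finite) set" where
  "unit_cube = {x. \<forall>i. 0 \<le> x $ i \<and> x $ i < 1}"

text \<open>
  Lebesgue measure on the torus, as the image of Lebesgue measure on a fundamental domain of the
  integer lattice. It lives on the Borel sets; since elements of \<open>L\<^sup>p\<close> are only
  considered up to null sets, there is no need to complete it.
\<close>
definition torus_measure :: "'n::finite torus measure" where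
  "torus_measure = distr (restrict_space lborel unit_cube) borel to_torus"

lemma measurable_to_torus [measurable]: "to_torus \<in> borel_measurable borel"
proof (rule borel_measurableI)
  fix S :: "'n::finite torus set" assume "open S"
  then have "open (to_torus -` S)" by (simp add: open_torus_def)
  then show "to_torus -` S \<inter> space borel \<in> sets borel" by simp
qed

lemma space_torus_measure [simp]: "space torus_measure = UNIV"
  and sets_torus_measure [simp, measurable_cong]: "sets torus_measure = sets borel"
  by (simp_all add: torus_measure_def)

lemma emeasure_torus_measure: "emeasure (torus_measure :: 'n::finite torus measure) UNIV = 1"
proof -
  have cube: "(unit_cube :: (real ^ 'n) set) \<in> sets lborel"
    unfolding unit_cube_def by measurable
  have "box 0 1 \<subseteq> (unit_cube :: (real ^ 'n) set)" "(unit_cube :: (real ^ 'n) set) \<subseteq> cbox 0 1"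
    by (auto simp: unit_cube_def mem_box_cart less_imp_le)
  then have "emeasure lborel (box 0 (1 :: real ^ 'n)) \<le> emeasure lborel (unit_cube :: (real ^ 'n) set)"
    "emeasure lborel (unit_cube :: (real ^ 'n) set) \<le> emeasure lborel (cbox 0 (1 :: real ^ 'n))"
    using cube by (auto intro!: emeasure_mono)
  moreover have "emeasure lborel (box 0 (1 :: real ^ 'n)) = 1" "emeasure lborel (cbox 0 (1 :: real ^ 'n)) = 1"
    by (auto simp: emeasure_lborel_box_eq emeasure_lborel_cbox_eq Basis_vec_def inner_axis
        intro!: prod.neutral)
  ultimately have "emeasure lborel (unit_cube :: (real ^ 'n) set) = 1"
    by simp
  moreover have "(to_torus :: real ^ 'n \<Rightarrow> _) \<in> borel_measurable (restrict_space lborel unit_cube)"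
    by (rule measurable_restrict_space1) simp
  ultimately show ?thesis
    using cube by (simp add: torus_measure_def emeasure_distr emeasure_restrict_space space_restrict_space)
qed

section \<open>Essential oscillation\<close>

definition essinf ::
  "'a measure \<Rightarrow> ('a \<Rightarrow> 'b::{second_countable_topology, dense_linorder, linorder_topology, complete_linorder}) \<Rightarrow> 'b"
  where "essinf M f = (if f \<in> borel_measurable M then Liminf (ae_filter M) f else bot)"

definition ess_osc :: "'a measure \<Rightarrow> ('a \<Rightarrow> real) \<Rightarrow> ereal" where
  "ess_osc M f = esssup M (\<lambda>x. ereal (f x)) - essinf M (\<lambda>x. ereal (f x))"

definition L_infinity :: "'a measure \<Rightarrow> ('a \<Rightarrow> real) set" where
  "L_infinity M = {f \<in> borel_measurable M. esssup M (\<lambda>x. ereal \<bar>f x\<bar>) < \<infinity>}"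

section \<open>The free energy\<close>

definition torus_conv :: "('n::finite torus \<Rightarrow> real) \<Rightarrow> ('n torus \<Rightarrow> real) \<Rightarrow> 'n torus \<Rightarrow> real" where
  "torus_conv W \<rho> x = (LINT y|torus_measure. W (x - y) * \<rho> y)"

text \<open>
  Since \<open>t * ln t\<close> is bounded below on \<open>t \<ge> 0\<close> and the torus has finite measure, the integral of
  \<open>\<rho> * ln \<rho>\<close> always exists in \<open>(-\<infinity>, \<infinity>]\<close> for nonnegative \<open>\<rho>\<close>, and it is finite iff \<open>\<rho> * ln \<rho>\<close>
  is integrable. The convention \<open>0 * ln 0 = 0\<close> holds automatically.
\<close>
definition finite_entropy :: "('n::finite torus \<Rightarrow> real) \<Rightarrow> bool" where
  "finite_entropy \<rho> \<longleftrightarrow> integrable torus_measure (\<lambda>x. \<rho> x * ln (\<rho> x))"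

definition free_energy :: "real \<Rightarrow> ('n::finite torus \<Rightarrow> real) \<Rightarrow> ('n torus \<Rightarrow> real) \<Rightarrow> ereal" where
  "free_energy \<beta> W \<rho> =
    (if finite_entropy \<rho>
     then ereal ((LINT x|torus_measure. \<rho> x * (ln (\<rho> x) - 1))
                 - \<beta> * (LINT x|torus_measure. \<rho> x * torus_conv W \<rho> x))
     else \<infinity>)"

definition densities :: "real \<Rightarrow> ('n::finite torus \<Rightarrow> real) set" where
  "densities M =
    {\<rho>. integrable torus_measure \<rho> \<and> (AE x in torus_measure. 0 \<le> \<rho> x) \<and>
        (LINT x|torus_measure. \<rho> x) = M \<and> finite_entropy \<rho>}"

end

theory Submission
  imports Defs "HOL-Probability.Probability_Measure"
begin

text \<open>
  Write \<open>\<rho> = M + f\<close> with \<open>f\<close> of mean zero. Since the convolution of \<open>W\<close> with a constant is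
  constant, the interaction energies of \<open>\<rho>\<close> and of the constant density differ by \<open>\<integral> f (W * f)\<close>,
  which is at most half the oscillation of \<open>W\<close> times \<open>\<parallel>f\<parallel>\<^sub>1\<^sup>2\<close>. By Pinsker's inequality the entropies
  differ by at least \<open>\<parallel>f\<parallel>\<^sub>1\<^sup>2 / (2 * M)\<close>. So the energy gap is at least
  \<open>(1 - M * \<beta> * osc W) / (2 * M) * \<parallel>f\<parallel>\<^sub>1\<^sup>2\<close>.
\<close>

section \<open>Pinsker's inequality\<close>

text \<open>The denominator t + 2 of this rational lower bound for the entropy function is linear,
  so along a density its integral depends on the mass alone. Clearing it keeps the bound polynomial
  and includes t = 0.\<close>

lemma entropy_lower_bound:
  fixes t :: real
  assumes "0 \<le> t"
  shows "3 * (t - 1)\<^sup>2 \<le> 2 * (t + 2) * (t * ln t - t + 1)"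
proof (cases "t = 0")
  case False
  with assms have t: "t > 0" by simp
  \<comment> \<open>The bracket is \<open>(u - 1)\<^sup>2 / (u + 2)\<close> in partial fractions; \<open>g\<close> is convex with a double zero at 1.\<close>
  define g where "g u = u * ln u - u + 1 - (3/2) * ((u + 2) - 6 + 9 / (u + 2))" for u :: real
  define g' where "g' u = ln u - (3/2) * (1 - 9 / (u + 2)^2)" for u :: real
  define g'' where "g'' u = 1 / u - 27 / (u + 2)^3" for u :: real
  have d1: "(g has_real_derivative g' u) (at u)" if "u > 0" for u
    unfolding g_def g'_def using that
    by (auto intro!: derivative_eq_intros simp: field_simps power2_eq_square)
  have d2: "(g' has_real_derivative g'' u) (at u)" if "u > 0" for u
    unfolding g''_def g'_def using that
    by (auto intro!: derivative_eq_intros) (simp add: divide_simps, simp add: eval_nat_numeral algebra_simps)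
  have nn: "g'' u \<ge> 0" if "u > 0" for u
  proof -
    \<comment> \<open>This is AM-GM for the three numbers u, 1, 1 in factored form.\<close>
    have "(u + 2)^3 - 27 * u = (u - 1)^2 * (u + 8)"
      by (simp add: eval_nat_numeral algebra_simps)
    with that have "27 * u \<le> (u + 2)^3" by (smt (verit) mult_nonneg_nonneg zero_le_power2)
    then show ?thesis using that by (simp add: g''_def field_simps)
  qed
  have "convex_on {0<..} g"
    by (rule f''_ge0_imp_convex[where f' = g' and f'' = g'']) (use d1 d2 nn in auto)
  then have "g t - g 1 \<ge> g' 1 * (t - 1)"
    by (rule convex_on_imp_above_tangent[where A = "{0<..}"])
       (use t d1 in \<open>auto simp: interior_open intro: has_field_derivative_at_within connected_Ioi\<close>)
  then have "g t \<ge> 0" by (simp add: g_def g'_def)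
  then have "0 \<le> 2 * (t + 2) * g t" using t by simp
  also have "\<dots> = 2 * (t + 2) * (t * ln t - t + 1) - 3 * (t - 1)\<^sup>2"
    using t by (simp add: g_def field_simps power2_eq_square)
  finally show ?thesis by simp
qed simp

text \<open>The pointwise entropy bound is applied to \<open>\<rho> x / m\<close> and then
  integrated; the right-hand side is 2 * m times the relative entropy of \<rho> with respect to the
  constant m.\<close>

lemma (in prob_space) Pinsker_inequality:
  fixes \<rho> :: "'a \<Rightarrow> real"
  assumes m: "m > 0" and int: "integrable M \<rho>" and nonneg: "AE x in M. 0 \<le> \<rho> x"
    and mass: "(LINT x|M. \<rho> x) = m" and ent: "integrable M (\<lambda>x. \<rho> x * ln (\<rho> x))"
  shows "(LINT x|M. \<bar>\<rho> x - m\<bar>)\<^sup>2 \<le> 2 * m * ((LINT x|M. \<rho> x * ln (\<rho> x)) - m * ln m)"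
proof -
  \<comment> \<open>This is m times the entropy function at \<open>\<rho> x / m\<close>. The terms
    \<open>- \<rho> x + m\<close> make it pointwise nonnegative and cancel after
    integration.\<close>
  define h where "h x = \<rho> x * ln (\<rho> x) - ln m * \<rho> x - \<rho> x + m" for x
  define N where "N = (LINT x|M. \<bar>\<rho> x - m\<bar>)"
  have int_h: "integrable M h" unfolding h_def using int ent by simp
  have lint_h: "(LINT x|M. h x) = (LINT x|M. \<rho> x * ln (\<rho> x)) - m * ln m"
    unfolding h_def using int ent mass by (simp add: prob_space)
  have pt: "3 * (\<rho> x - m)\<^sup>2 \<le> 2 * (\<rho> x + 2 * m) * h x" if "0 \<le> \<rho> x" for x
  proof -
    have h: "h x = m * (\<rho> x / m * ln (\<rho> x / m) - \<rho> x / m + 1)"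
      using m that by (cases "\<rho> x = 0") (auto simp: h_def ln_div field_simps)
    have "m\<^sup>2 * (3 * (\<rho> x / m - 1)\<^sup>2)
        \<le> m\<^sup>2 * (2 * (\<rho> x / m + 2) * (\<rho> x / m * ln (\<rho> x / m) - \<rho> x / m + 1))"
      using m that by (intro mult_left_mono entropy_lower_bound) auto
    also have "\<dots> = 2 * (\<rho> x + 2 * m) * h x"
      unfolding h using m by (simp add: power2_eq_square field_simps)
    also have "m\<^sup>2 * (3 * (\<rho> x / m - 1)\<^sup>2) = 3 * (\<rho> x - m)\<^sup>2"
      using m by (simp add: power2_eq_square field_simps)
    finally show ?thesis .
  qed
  have h_nonneg: "0 \<le> h x" if "0 \<le> \<rho> x" for x
  proof -
    have "0 \<le> 2 * (\<rho> x + 2 * m) * h x" using pt[OF that] by (smt (verit) zero_le_power2)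
    moreover have "0 < 2 * (\<rho> x + 2 * m)" using m that by simp
    ultimately show ?thesis by (simp add: zero_le_mult_iff)
  qed
  have "N \<ge> 0" unfolding N_def by simp
  have "N\<^sup>2 \<le> 2 * m * (LINT x|M. h x)"
  \<comment> \<open>The weight m / N below requires N to be nonzero.\<close>
  proof (cases "N = 0")
    case True
    have "0 \<le> (LINT x|M. h x)"
      using nonneg h_nonneg by (intro integral_nonneg_AE) auto
    with True m show ?thesis by simp
  next
    case False
    with \<open>N \<ge> 0\<close> have N: "N > 0" by simp
    \<comment> \<open>AM-GM with the weight that is optimal after integration; it replaces Cauchy-Schwarz.\<close>
    have amgm: "\<bar>\<rho> x - m\<bar> \<le> N / (6 * m) * (\<rho> x + 2 * m) + m / N * h x" if "0 \<le> \<rho> x" for x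
    proof (rule power2_le_imp_le)
      define a b where "a = N / (6 * m) * (\<rho> x + 2 * m)" and "b = m / N * h x"
      have "\<bar>\<rho> x - m\<bar>\<^sup>2 \<le> 4 * (a * b)"
      proof -
        have "a * b = (\<rho> x + 2 * m) * h x / 6"
          using m N by (simp add: a_def b_def field_simps)
        with pt[OF that] show ?thesis by (simp add: algebra_simps)
      qed
      also have "\<dots> = (a + b)\<^sup>2 - (a - b)\<^sup>2"
        by (simp add: power2_eq_square algebra_simps)
      also have "\<dots> \<le> (a + b)\<^sup>2" by simp
      finally show "\<bar>\<rho> x - m\<bar>\<^sup>2 \<le> (N / (6 * m) * (\<rho> x + 2 * m) + m / N * h x)\<^sup>2"
        by (simp add: a_def b_def)
      show "0 \<le> N / (6 * m) * (\<rho> x + 2 * m) + m / N * h x"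
        using m N that h_nonneg by simp
    qed
    have "N \<le> (LINT x|M. N / (6 * m) * (\<rho> x + 2 * m) + m / N * h x)"
      unfolding N_def[symmetric] using nonneg amgm int int_h
      by (subst N_def) (intro integral_mono_AE, auto)
    \<comment> \<open>Since \<open>\<rho> x + 2 * m\<close> has integral 3 * m, the first term
      integrates to N / 2, which is then absorbed on the left.\<close>
    also have "\<dots> = N / 2 + m / N * (LINT x|M. h x)"
      using int int_h mass m by (simp add: prob_space)
    finally show ?thesis using N by (simp add: field_simps power2_eq_square)
  qed
  then show ?thesis by (simp add: N_def lint_h)
qed

section \<open>Coordinates on the torus and measurability of subtraction\<close>

lemma to_torus_eq_iff: "to_torus u = to_torus v \<longleftrightarrow> (\<forall>i. u $ i - v $ i \<in> \<int>)"
  using torus.abs_eq_iff[of u v] by (simp add: int_equiv_def)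

lemma unit_cube_borel [measurable]: "unit_cube \<in> sets borel"
  unfolding unit_cube_def by measurable

lemma prob_space_torus_measure: "prob_space torus_measure"
  by (rule prob_spaceI) (simp add: emeasure_torus_measure)

text \<open>These are the coordinates of the representative in \<open>unit_cube\<close>. Fractional
  parts ignore integer shifts, so they descend to the quotient.\<close>

lift_definition torus_coord :: "'n::finite \<Rightarrow> 'n torus \<Rightarrow> real" is "\<lambda>i v. frac (v $ i)"
proof -
  fix i :: 'n and u v :: "real ^ 'n" assume "int_equiv u v"
  then obtain k :: int where "u $ i - v $ i = of_int k"
    by (auto simp: int_equiv_def elim: Ints_cases)
  then have "u $ i = v $ i + of_int k" by simp
  then show "frac (u $ i) = frac (v $ i)" by simp
qed

lemma to_torus_coord: "to_torus (\<chi> i. torus_coord i x) = x"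
proof (induction x rule: torus.abs_induct)
  case (1 v)
  then show ?case
    unfolding to_torus_eq_iff by (auto simp: torus_coord.abs_eq frac_def)
qed

text \<open>A coordinate jumps only where it vanishes, so a sublevel set is empty or the union of a
  closed set (coordinate zero) and an open set (coordinate strictly between 0 and the
  level).\<close>

lemma measurable_torus_coord [measurable]: "torus_coord i \<in> borel_measurable borel"
proof (rule borel_measurable_iff_less[THEN iffD2], rule allI)
  fix c :: real
  define Z where "Z = {x. torus_coord i x = 0}"
  \<comment> \<open>The cap at 1 keeps each interval of the preimage between consecutive integers,
    so that k is the floor even when c > 1.\<close>
  define U where "U = {x. 0 < torus_coord i x \<and> torus_coord i x < min c 1}"
  have "to_torus -` Z = (\<lambda>v. v $ i) -` \<int>"
    by (auto simp: Z_def torus_coord.abs_eq)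
  moreover have "closed ((\<lambda>v::real^'a. v $ i) -` \<int>)"
    by (intro closed_vimage continuous_intros) simp
  ultimately have "closed Z"
    by (simp add: closed_def open_torus_def vimage_Compl)
  have "to_torus -` U = (\<Union>k::int. {v. of_int k < v $ i \<and> v $ i < of_int k + min c 1})"
  proof (intro set_eqI iffI)
    fix v assume "v \<in> to_torus -` U"
    then show "v \<in> (\<Union>k::int. {v. of_int k < v $ i \<and> v $ i < of_int k + min c 1})"
      by (auto simp: U_def torus_coord.abs_eq frac_def intro!: exI[of _ "\<lfloor>v $ i\<rfloor>"])
  next
    fix v :: "real^'a" assume "v \<in> (\<Union>k::int. {v. of_int k < v $ i \<and> v $ i < of_int k + min c 1})"
    then obtain k :: int where k: "of_int k < v $ i" "v $ i < of_int k + min c 1" by auto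
    then have "\<lfloor>v $ i\<rfloor> = k" by linarith
    with k show "v \<in> to_torus -` U" by (auto simp: U_def torus_coord.abs_eq frac_def)
  qed
  moreover have "open (\<Union>k::int. {v::real^'a. of_int k < v $ i \<and> v $ i < of_int k + min c 1})"
    by (intro open_UN ballI open_Collect_conj open_Collect_less continuous_intros)
  ultimately have "open U" by (simp add: open_torus_def)
  have range: "0 \<le> torus_coord i x \<and> torus_coord i x < 1" for x
    by transfer (simp add: frac_lt_1)
  have "torus_coord i x < c \<longleftrightarrow> x \<in> (if c > 0 then Z \<union> U else {})" for x
    using range[of x] by (auto simp: Z_def U_def)
  then have "{x. torus_coord i x < c} = (if c > 0 then Z \<union> U else {})"
    by blast
  then show "{x \<in> space borel. torus_coord i x < c} \<in> sets borel"
    using \<open>closed Z\<close> \<open>open U\<close> by auto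
qed

text \<open>Without a second-countability instance for the quotient topology, continuity on the product space
  does not give measurability for the product sigma algebra; the Borel section given by \<open>torus_coord\<close>
  does.\<close>
lemma measurable_minus_torus [measurable]:
  "(\<lambda>(x, y). x - y :: 'n::finite torus) \<in> borel \<Otimes>\<^sub>M borel \<rightarrow>\<^sub>M borel"
proof -
  have "(\<lambda>(x, y). x - y :: 'n torus)
      = (\<lambda>p. to_torus (\<chi> i. torus_coord i (fst p) - torus_coord i (snd p)))"
  proof (intro ext, clarify)
    fix x y :: "'n torus"
    have "x - y = to_torus (\<chi> i. torus_coord i x) - to_torus (\<chi> i. torus_coord i y)"
      by (simp add: to_torus_coord)
    also have "\<dots> = to_torus (\<chi> i. torus_coord i x - torus_coord i y)"
      by (simp add: minus_torus.abs_eq minus_vec_def)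
    finally show "x - y = to_torus (\<chi> i. torus_coord i (fst (x, y)) - torus_coord i (snd (x, y)))"
      by simp
  qed
  moreover
  have "(\<lambda>p. \<chi> i. torus_coord i (fst p) - torus_coord i (snd p))
      \<in> borel \<Otimes>\<^sub>M borel \<rightarrow>\<^sub>M (borel :: (real^'n) measure)"
  proof (rule borel_measurable_euclidean_space[THEN iffD2], rule ballI)
    fix b :: "real ^ 'n" assume "b \<in> Basis"
    then obtain i where b: "b = axis i 1" by (auto simp: Basis_vec_def)
    have "(\<lambda>p. torus_coord i (fst p) - torus_coord i (snd p)) \<in> borel_measurable (borel \<Otimes>\<^sub>M borel)"
      by measurable
    then show "(\<lambda>p. (\<chi> i. torus_coord i (fst p) - torus_coord i (snd p)) \<bullet> b)
        \<in> borel_measurable (borel \<Otimes>\<^sub>M borel)"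
      by (simp add: b inner_axis)
  qed
  then have "(\<lambda>p. to_torus (\<chi> i. torus_coord i (fst p) - torus_coord i (snd p)) :: 'n torus)
      \<in> borel \<Otimes>\<^sub>M borel \<rightarrow>\<^sub>M borel"
    by (rule measurable_compose[OF _ measurable_to_torus])
  ultimately show ?thesis by simp
qed

text \<open>Composed form, so that integrands such as \<open>V (x - y) * f y\<close> are handled
  automatically.\<close>

lemma measurable_torus_diff [measurable]:
  fixes f g :: "'a \<Rightarrow> 'n::finite torus"
  assumes [measurable]: "f \<in> M \<rightarrow>\<^sub>M borel" "g \<in> M \<rightarrow>\<^sub>M borel"
  shows "(\<lambda>x. f x - g x) \<in> M \<rightarrow>\<^sub>M borel"
  using measurable_compose[OF measurable_Pair[OF assms] measurable_minus_torus] by simp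

section \<open>Translation invariance of the torus measure\<close>

lemma emeasure_torus:
  assumes "A \<in> sets borel"
  shows "emeasure torus_measure A = emeasure lborel (to_torus -` A \<inter> unit_cube)"
proof -
  have "to_torus \<in> borel_measurable (restrict_space lborel unit_cube)"
    by (rule measurable_restrict_space1) simp
  then show ?thesis using assms
    unfolding torus_measure_def
    by (subst emeasure_distr) (simp_all add: emeasure_restrict_space space_restrict_space)
qed

text \<open>The shifted cube is cut along the integer lattice and its pieces are moved back into the unit cube.\<close>
lemma emeasure_unit_cube_shift:
  fixes B :: "(real ^ 'n::finite) set" and v :: "real ^ 'n"
  assumes [measurable]: "B \<in> sets borel"
    and per: "\<And>u k::real ^ 'n. (\<forall>i. k $ i \<in> \<int>) \<Longrightarrow> u + k \<in> B \<longleftrightarrow> u \<in> B"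
  shows "emeasure lborel {u. u + v \<in> B \<and> u \<in> unit_cube} = emeasure lborel (B \<inter> unit_cube)"
proof -
  define e :: "int ^ 'n \<Rightarrow> real ^ 'n" where "e k = (\<chi> i. of_int (k $ i))" for k
  \<comment> \<open>\<open>P k\<close> holds the points that the shift by v sends into the lattice
    cell at \<open>e k\<close>; translation by \<open>v - e k\<close> carries it onto
    \<open>Q k\<close>.\<close>
  define P where "P k = {u. u + v \<in> B \<and> u \<in> unit_cube \<and> (u + v) - e k \<in> unit_cube}" for k
  define Q where "Q k = {u. u \<in> B \<and> u \<in> unit_cube \<and> (u - v) + e k \<in> unit_cube}" for k
  have P: "P k \<in> sets lborel" for k
    unfolding P_def by measurable
  have Q: "Q k \<in> sets lborel" for k
    unfolding Q_def by measurable
  \<comment> \<open>Exactly one lattice vector, the vector of floors, brings a point into the cube.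
    Hence the pieces are disjoint and exhaust the set.\<close>
  have frac: "u - e k \<in> unit_cube \<longleftrightarrow> k = (\<chi> i. \<lfloor>u $ i\<rfloor>)" for u k
  proof -
    have "u - e k \<in> unit_cube \<longleftrightarrow> (\<forall>i. \<lfloor>u $ i\<rfloor> = k $ i)"
      by (auto simp: unit_cube_def e_def floor_eq_iff algebra_simps)
    then show ?thesis by (auto simp: vec_eq_iff)
  qed
  have frac': "u + e k \<in> unit_cube \<longleftrightarrow> k = - (\<chi> i. \<lfloor>u $ i\<rfloor>)" for u k
  proof -
    have "e (- k) = - e k" by (simp add: e_def vec_eq_iff)
    with frac[of u "- k"] have "u + e k \<in> unit_cube \<longleftrightarrow> - k = (\<chi> i. \<lfloor>u $ i\<rfloor>)" by simp
    then show ?thesis by (metis minus_minus)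
  qed
  have shift: "emeasure lborel (P k) = emeasure lborel (Q k)" for k
  proof -
    have "emeasure lborel (Q k) = emeasure (distr lborel borel (\<lambda>u. (v - e k) + u)) (Q k)"
      by (simp add: lborel_distr_plus)
    also have "\<dots> = emeasure lborel ((\<lambda>u. (v - e k) + u) -` Q k)"
      by (subst emeasure_distr) (use Q in auto)
    also have "(\<lambda>u. (v - e k) + u) -` Q k = P k"
    proof -
      \<comment> \<open>Periodicity of B enters here: moving a piece back by a lattice vector
        preserves membership.\<close>
      have "u + v - e k \<in> B \<longleftrightarrow> u + v \<in> B" for u
        using per[of "- e k" "u + v"] by (simp add: e_def)
      then show ?thesis
        by (auto simp: P_def Q_def algebra_simps)
    qed
    finally show ?thesis by simp
  qed
  have "emeasure lborel {u. u + v \<in> B \<and> u \<in> unit_cube} = emeasure lborel (\<Union>k. P k)"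
    by (rule arg_cong[where f = "emeasure lborel"]) (auto simp: P_def frac)
  also have "\<dots> = (\<integral>\<^sup>+k. emeasure lborel (P k) \<partial>count_space UNIV)"
    by (rule emeasure_UN_countable[OF P]) (auto simp: P_def disjoint_family_on_def frac)
  also have "\<dots> = (\<integral>\<^sup>+k. emeasure lborel (Q k) \<partial>count_space UNIV)"
    by (simp add: shift)
  also have "\<dots> = emeasure lborel (\<Union>k. Q k)"
    by (rule emeasure_UN_countable[OF Q, symmetric]) (auto simp: Q_def disjoint_family_on_def frac')
  also have "(\<Union>k. Q k) = B \<inter> unit_cube"
    by (auto simp: Q_def frac')
  finally show ?thesis .
qed

text \<open>The torus measure is Haar measure: preimages under \<open>to_torus\<close> are periodic,
  so the cube may be shifted by a representative of \<open>- a\<close>.\<close>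

lemma distr_torus_measure_minus: "distr torus_measure borel (\<lambda>x. x - a) = torus_measure"
proof (rule measure_eqI)
  fix A :: "'a torus set" assume "A \<in> sets (distr torus_measure borel (\<lambda>x. x - a))"
  then have A [measurable]: "A \<in> sets borel" by simp
  define v where "v = - rep_torus a"
  have a: "to_torus (u + v) = to_torus u - a" for u
  proof -
    have "a = to_torus (rep_torus a)" by (simp add: Quotient3_abs_rep[OF Quotient3_torus])
    then show ?thesis by (metis minus_torus.abs_eq v_def diff_conv_add_uminus)
  qed
  have "emeasure (distr torus_measure borel (\<lambda>x. x - a)) A = emeasure torus_measure ((\<lambda>x. x - a) -` A)"
    by (subst emeasure_distr) auto
  also have "\<dots> = emeasure lborel (to_torus -` ((\<lambda>x. x - a) -` A) \<inter> unit_cube)"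
    using measurable_sets[of "\<lambda>x. x - a" borel borel A] by (intro emeasure_torus) auto
  also have "to_torus -` ((\<lambda>x. x - a) -` A) \<inter> unit_cube = {u. u + v \<in> to_torus -` A \<and> u \<in> unit_cube}"
    by (auto simp: a)
  also have "emeasure lborel \<dots> = emeasure lborel (to_torus -` A \<inter> unit_cube)"
  proof (rule emeasure_unit_cube_shift)
    show "to_torus -` A \<in> sets borel"
      using measurable_sets[OF measurable_to_torus A] by simp
    fix u k :: "real ^ 'a" assume "\<forall>i. k $ i \<in> \<int>"
    then have "to_torus (u + k) = to_torus u" by (simp add: to_torus_eq_iff)
    then show "u + k \<in> to_torus -` A \<longleftrightarrow> u \<in> to_torus -` A" by simp
  qed
  also have "\<dots> = emeasure torus_measure A" by (simp add: emeasure_torus)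
  finally show "emeasure (distr torus_measure borel (\<lambda>x. x - a)) A = emeasure torus_measure A" .
qed simp

lemma borel_measurable_torus_measure_eq: "borel_measurable torus_measure = borel_measurable borel"
  by (rule measurable_cong_sets) simp_all

lemma AE_torus_shift:
  assumes "AE x in torus_measure. P x"
  shows "AE x in torus_measure. P (x - a)"
proof (rule AE_distrD[where f = "\<lambda>x. x - a" and M' = borel])
  show "AE x in distr torus_measure borel (\<lambda>x. x - a). P x"
    unfolding distr_torus_measure_minus by (rule assms)
qed measurable

lemma integral_torus_shift:
  fixes g :: "'n::finite torus \<Rightarrow> real"
  assumes [measurable]: "g \<in> borel_measurable borel"
  shows "(LINT x|torus_measure. g (x - a)) = (LINT x|torus_measure. g x)"
proof -
  have "(LINT x|torus_measure. g x) = (LINT x|distr torus_measure borel (\<lambda>x. x - a). g x)"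
    by (simp add: distr_torus_measure_minus)
  also have "\<dots> = (LINT x|torus_measure. g (x - a))"
    by (rule integral_distr) measurable
  finally show ?thesis by simp
qed

section \<open>Essential bounds and the interaction energy\<close>

text \<open>Essential boundedness makes the essential supremum and infimum finite, so the
  extended-real oscillation becomes a difference of real bounds that hold almost everywhere.\<close>

lemma (in prob_space) L_infinity_essential_bounds:
  assumes "f \<in> L_infinity M"
  obtains a b where "a \<le> b" "AE x in M. a \<le> f x \<and> f x \<le> b" "ess_osc M f = ereal (b - a)"
proof -
  have f [measurable]: "f \<in> borel_measurable M" and fin: "esssup M (\<lambda>x. ereal \<bar>f x\<bar>) < \<infinity>"
    using assms by (auto simp: L_infinity_def)
  define s where "s = esssup M (\<lambda>x. ereal (f x))"
  define i where "i = essinf M (\<lambda>x. ereal (f x))"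
  obtain n :: nat where "esssup M (\<lambda>x. ereal \<bar>f x\<bar>) < ereal n"
    using fin by (auto simp: less_PInf_Ex_of_nat)
  then have n: "esssup M (\<lambda>x. ereal \<bar>f x\<bar>) \<le> ereal n" by (rule less_imp_le)
  have bnd: "AE x in M. \<bar>f x\<bar> \<le> n"
    using esssup_AE[of "\<lambda>x. ereal \<bar>f x\<bar>" M] 
  proof eventually_elim
    case (elim x)
    then have "ereal \<bar>f x\<bar> \<le> ereal n" using n by (rule order_trans)
    then show ?case by simp
  qed
  have i: "i = Liminf (ae_filter M) (\<lambda>x. ereal (f x))"
    by (simp add: i_def essinf_def)
  have s: "s = Limsup (ae_filter M) (\<lambda>x. ereal (f x))"
    by (simp add: s_def esssup_def)
  \<comment> \<open>A probability measure is nonzero, so its almost-everywhere filter is proper;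
    this is what orders the lower limit below the upper one.\<close>
  have nontriv: "ae_filter M \<noteq> bot" using ae_filter_bot by simp
  have "i \<le> s" unfolding i s using nontriv by (rule Liminf_le_Limsup)
  have "s \<le> ereal n" unfolding s
    using bnd by (intro Limsup_bounded) (auto elim: eventually_mono)
  have "ereal (- n) \<le> i" unfolding i
    using bnd by (intro Liminf_bounded) (auto elim: eventually_mono)
  obtain b where b: "s = ereal b" using \<open>s \<le> ereal n\<close> \<open>ereal (- n) \<le> i\<close> \<open>i \<le> s\<close>
    by (cases s) auto
  obtain a where a: "i = ereal a" using \<open>s \<le> ereal n\<close> \<open>ereal (- n) \<le> i\<close> \<open>i \<le> s\<close>
    by (cases i) auto
  have "AE x in M. f x \<le> b"
    using esssup_AE[of "\<lambda>x. ereal (f x)" M] b by (simp add: s_def)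
  moreover have "AE x in M. a \<le> f x"
  proof -
    \<comment> \<open>The lower bound is the upper bound for the negated function.\<close>
    have "esssup M (\<lambda>x. - ereal (f x)) = - i"
      using ereal_Limsup_uminus[of "ae_filter M" "\<lambda>x. ereal (f x)"] 
      by (simp add: esssup_def i del: uminus_ereal.simps)
    with esssup_AE[of "\<lambda>x. - ereal (f x)" M] show ?thesis by (simp add: a)
  qed
  ultimately have "AE x in M. a \<le> f x \<and> f x \<le> b" by eventually_elim simp
  moreover have "ess_osc M f = ereal (b - a)"
    unfolding ess_osc_def s_def[symmetric] i_def[symmetric] by (simp add: a b)
  moreover have "a \<le> b" using \<open>i \<le> s\<close> by (simp add: a b)
  ultimately show ?thesis by (intro that)
qed

text \<open>Adding a constant to \<open>W\<close> does not change the interaction of mean-zero densities, so \<open>W\<close> may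
  be centred at the midpoint of its essential range, where it is bounded by half its oscillation.\<close>
lemma interaction_energy_deviation:
  fixes W \<rho> :: "'n::finite torus \<Rightarrow> real"
  assumes W [measurable]: "W \<in> borel_measurable borel"
    and even: "AE x in torus_measure. W (- x) = W x"
    and "a \<le> b" and range: "AE x in torus_measure. a \<le> W x \<and> W x \<le> b"
    and \<rho>: "integrable torus_measure \<rho>" and mass: "(LINT x|torus_measure. \<rho> x) = m"
  shows "\<bar>(LINT x|torus_measure. \<rho> x * torus_conv W \<rho> x) - m\<^sup>2 * (LINT x|torus_measure. W x)\<bar>
    \<le> (b - a) / 2 * (LINT x|torus_measure. \<bar>\<rho> x - m\<bar>)\<^sup>2"
proof -
  let ?T = "torus_measure :: 'n torus measure"
  interpret T: prob_space ?T by (rule prob_space_torus_measure)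
  interpret TT: pair_sigma_finite ?T ?T ..
  have prob1: "measure ?T UNIV = 1" using T.prob_space by simp
  define c r where "c = (a + b) / 2" and "r = (b - a) / 2"
  have "r \<ge> 0" using \<open>a \<le> b\<close> by (simp add: r_def)
  \<comment> \<open>Truncation changes \<open>W - c\<close> only on a null set, but makes the bound
    r hold everywhere. The estimates for K then hold at every x.\<close>
  define V where "V z = max (- r) (min r (W z - c))" for z
  define f where "f x = \<rho> x - m" for x
  define K where "K x = (LINT y|?T. V (x - y) * f y)" for x
  have V [measurable]: "V \<in> borel_measurable borel" unfolding V_def by measurable
  have V_bound: "\<bar>V z\<bar> \<le> r" for z using \<open>r \<ge> 0\<close> by (auto simp: V_def)
  have int_V: "integrable ?T (\<lambda>y. V (g y))" if [measurable]: "g \<in> borel \<rightarrow>\<^sub>M borel" for g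
    by (rule T.integrable_const_bound[where B = r]) (use V_bound in auto)
  have f_int: "integrable ?T f" unfolding f_def using \<rho> by simp
  then have f_meas [measurable]: "f \<in> borel_measurable borel"
    using borel_measurable_integrable borel_measurable_torus_measure_eq by blast
  have f_zero: "(LINT x|?T. f x) = 0"
    unfolding f_def using \<rho> mass by (simp add: prob1)
  have int_Vf: "integrable ?T (\<lambda>y. V (x - y) * f y)" for x
    by (rule Bochner_Integration.integrable_bound[where f = "\<lambda>y. r * f y"])
       (use f_int V_bound \<open>r \<ge> 0\<close> in \<open>auto simp: abs_mult intro!: mult_right_mono\<close>)
  \<comment> \<open>The reflected point is included because the convolution evaluates W at
    \<open>x - y\<close>, while the translation lemma speaks of \<open>y - x\<close>.\<close>
  have in_range: "AE z in ?T. W (- z) = V (- z) + c \<and> W z = V z + c \<and> V (- z) = V z"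
    using even range by eventually_elim (auto simp: V_def r_def c_def field_simps)
  have mean_W: "(LINT x|?T. W x) = (LINT x|?T. V x) + c"
  proof -
    have "(LINT x|?T. W x) = (LINT x|?T. V x + c)"
      by (rule integral_cong_AE) (use in_range in auto)
    also have "\<dots> = (LINT x|?T. V x) + c"
      using int_V[of "\<lambda>x. x"] by (simp add: prob1)
    finally show ?thesis .
  qed
  \<comment> \<open>Evenness turns \<open>x - y\<close> into \<open>y - x\<close>, and translation
    invariance removes x.\<close>
  have mean_V: "(LINT y|?T. V (x - y)) = (LINT y|?T. V y)" for x
  proof -
    have "(LINT y|?T. V (x - y)) = (LINT y|?T. V (y - x))"
    proof (rule integral_cong_AE)
      show "AE y in ?T. V (x - y) = V (y - x)"
        using AE_torus_shift[OF in_range, of x] by eventually_elim simp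
    qed measurable
    then show ?thesis by (simp add: integral_torus_shift)
  qed
  \<comment> \<open>Expand (V + c) * (f + m): the term c * f has mean zero, and the terms with
    factor m combine to m times the integral of W.\<close>
  have conv: "torus_conv W \<rho> x = K x + m * (LINT x|?T. W x)" for x
  proof -
    have "torus_conv W \<rho> x = (LINT y|?T. (V (x - y) * f y + c * f y) + (m * V (x - y) + c * m))"
      unfolding torus_conv_def
    proof (rule integral_cong_AE)
      show "AE y in ?T. W (x - y) * \<rho> y = (V (x - y) * f y + c * f y) + (m * V (x - y) + c * m)"
        using AE_torus_shift[OF in_range, of x]
        by eventually_elim (auto simp: f_def algebra_simps)
      show "(\<lambda>y. W (x - y) * \<rho> y) \<in> borel_measurable ?T"
        using borel_measurable_integrable[OF \<rho>] by measurable
    qed measurable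
    also have "\<dots> = K x + c * (LINT y|?T. f y) + (m * (LINT y|?T. V (x - y)) + c * m)"
      unfolding K_def using int_Vf f_int int_V[of "\<lambda>y. x - y"] by (simp add: prob1)
    also have "\<dots> = K x + m * (LINT x|?T. W x)"
      by (simp add: f_zero mean_V mean_W algebra_simps)
    finally show ?thesis .
  qed
  have K_meas [measurable]: "K \<in> borel_measurable ?T"
    unfolding K_def by measurable
  have K_bound: "\<bar>K x\<bar> \<le> r * (LINT y|?T. \<bar>f y\<bar>)" for x
  proof -
    have "\<bar>K x\<bar> \<le> (LINT y|?T. \<bar>V (x - y) * f y\<bar>)"
      unfolding K_def by (rule integral_abs_bound)
    also have "\<dots> \<le> (LINT y|?T. r * \<bar>f y\<bar>)"
    proof (rule integral_mono)
      show "integrable ?T (\<lambda>y. \<bar>V (x - y) * f y\<bar>)" using int_Vf by (rule integrable_abs)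
      show "integrable ?T (\<lambda>y. r * \<bar>f y\<bar>)" using f_int by simp
      show "\<bar>V (x - y) * f y\<bar> \<le> r * \<bar>f y\<bar>" for y
        unfolding abs_mult using V_bound by (intro mult_right_mono) auto
    qed
    finally show ?thesis by simp
  qed
  have K_int: "integrable ?T K"
    by (rule T.integrable_const_bound[where B = "r * (LINT y|?T. \<bar>f y\<bar>)"]) (use K_bound in auto)
  have fK_int: "integrable ?T (\<lambda>x. f x * K x)"
    by (rule Bochner_Integration.integrable_bound[where f = "\<lambda>x. f x * (r * (LINT y|?T. \<bar>f y\<bar>))"])
       (use f_int K_bound \<open>r \<ge> 0\<close> in \<open>auto simp: abs_mult intro!: mult_left_mono\<close>)
  \<comment> \<open>By Fubini and translation invariance the integral factors into the mean of V
    times the mean of f, which is zero.\<close>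
  have K_zero: "(LINT x|?T. K x) = 0"
  proof -
    have "integrable (?T \<Otimes>\<^sub>M ?T) (\<lambda>(x, y). V (x - y) * f y)"
    proof (rule Bochner_Integration.integrable_bound[where f = "\<lambda>(x, y). r * f y"])
      have "integrable (?T \<Otimes>\<^sub>M ?T) (\<lambda>(x, y). r * f y)"
      proof (rule TT.Fubini_integrable)
        show "integrable ?T (\<lambda>x. LINT y|?T. norm (case (x, y) of (x, y) \<Rightarrow> r * f y))"
          by simp
        show "AE x in ?T. integrable ?T (\<lambda>y. case (x, y) of (x, y) \<Rightarrow> r * f y)"
          using f_int by simp
      qed measurable
      then show "integrable (?T \<Otimes>\<^sub>M ?T) (\<lambda>(x, y). r * f y)" .
      show "AE p in ?T \<Otimes>\<^sub>M ?T. norm (case p of (x, y) \<Rightarrow> V (x - y) * f y)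
          \<le> norm (case p of (x, y) \<Rightarrow> r * f y)"
        using V_bound \<open>r \<ge> 0\<close> by (auto simp: abs_mult intro!: mult_right_mono AE_I2)
    qed measurable
    then have "(LINT x|?T. K x) = (LINT y|?T. LINT x|?T. V (x - y) * f y)"
      unfolding K_def by (rule TT.Fubini_integral[symmetric])
    also have "\<dots> = (LINT y|?T. (LINT x|?T. V x) * f y)"
      by (simp add: integral_torus_shift)
    finally show ?thesis by (simp add: f_zero)
  qed
  \<comment> \<open>With \<rho> = f + m, the cross term m * K integrates to zero, leaving the
    quadratic form in f and the energy of the constant density.\<close>
  have "(LINT x|?T. \<rho> x * torus_conv W \<rho> x)
      = (LINT x|?T. (f x * K x + m * K x) + (m * (LINT x|?T. W x)) * \<rho> x)"
    by (simp add: conv f_def algebra_simps)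
  also have "\<dots> = (LINT x|?T. f x * K x) + m\<^sup>2 * (LINT x|?T. W x)"
    using fK_int K_int \<rho> by (simp add: K_zero mass power2_eq_square)
  finally have "\<bar>(LINT x|?T. \<rho> x * torus_conv W \<rho> x) - m\<^sup>2 * (LINT x|?T. W x)\<bar>
      = \<bar>LINT x|?T. f x * K x\<bar>" by simp
  also have "\<dots> \<le> (LINT x|?T. \<bar>f x * K x\<bar>)" by (rule integral_abs_bound)
  also have "\<dots> \<le> (LINT x|?T. \<bar>f x\<bar> * (r * (LINT y|?T. \<bar>f y\<bar>)))"
  proof (rule integral_mono)
    show "integrable ?T (\<lambda>x. \<bar>f x * K x\<bar>)" using fK_int by (rule integrable_abs)
    show "integrable ?T (\<lambda>x. \<bar>f x\<bar> * (r * (LINT y|?T. \<bar>f y\<bar>)))" using f_int by simp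
    show "\<bar>f x * K x\<bar> \<le> \<bar>f x\<bar> * (r * (LINT y|?T. \<bar>f y\<bar>))" for x
      unfolding abs_mult using K_bound by (intro mult_left_mono) auto
  qed
  also have "\<dots> = r * (LINT x|?T. \<bar>f x\<bar>)\<^sup>2"
    by (simp add: power2_eq_square)
  finally show ?thesis by (simp add: r_def f_def)
qed

section \<open>Energy gap, minimality and uniqueness\<close>

theorem proposition6:
  fixes W :: "'n::finite torus \<Rightarrow> real" and M \<beta> :: real and \<rho>\<^sub>0 :: "'n torus \<Rightarrow> real"
  assumes "\<beta> > 0" and "M > 0"
    and "W \<in> L_infinity torus_measure"
    and "AE x in torus_measure. W (- x) = W x"
    and "ereal (M * \<beta>) * ess_osc torus_measure W < 1"
    and "\<rho>\<^sub>0 = (\<lambda>_. M / measure (torus_measure :: 'n torus measure) UNIV)"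
  shows "\<rho>\<^sub>0 \<in> densities M \<and>
    (\<forall>\<rho> \<in> densities M. free_energy \<beta> W \<rho>\<^sub>0 \<le> free_energy \<beta> W \<rho>) \<and>
    (\<forall>\<rho> \<in> densities M. (\<forall>\<sigma> \<in> densities M. free_energy \<beta> W \<rho> \<le> free_energy \<beta> W \<sigma>) \<longrightarrow>
       (AE x in torus_measure. \<rho> x = \<rho>\<^sub>0 x))"
proof -
  let ?T = "torus_measure :: 'n torus measure"
  interpret T: prob_space ?T by (rule prob_space_torus_measure)
  have \<rho>\<^sub>0: "\<rho>\<^sub>0 = (\<lambda>_. M)" using assms(6) T.prob_space by simp
  obtain a b where ab: "a \<le> b" "AE x in ?T. a \<le> W x \<and> W x \<le> b" "ess_osc ?T W = ereal (b - a)"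
    using T.L_infinity_essential_bounds[OF assms(3)] by blast
  have small: "M * \<beta> * (b - a) < 1" using assms(5) by (simp add: ab(3))
  have W: "W \<in> borel_measurable borel" 
    using assms(3) by (simp add: L_infinity_def borel_measurable_torus_measure_eq)
  note interaction = interaction_energy_deviation[OF W assms(4) ab(1,2)]
  define w where "w = (LINT x|?T. W x)"
  have mem: "\<rho>\<^sub>0 \<in> densities M"
    using \<open>M > 0\<close> T.prob_space by (simp add: \<rho>\<^sub>0 densities_def finite_entropy_def)
  \<comment> \<open>For the constant density the right-hand side of the deviation estimate vanishes,
    so its interaction energy is determined exactly.\<close>
  have energy0: "free_energy \<beta> W \<rho>\<^sub>0 = ereal (M * (ln M - 1) - \<beta> * (M\<^sup>2 * w))"
    using interaction[of "\<lambda>_. M" M] T.prob_space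
    by (simp add: \<rho>\<^sub>0 free_energy_def finite_entropy_def w_def)
  \<comment> \<open>Pinsker contributes 1 / (2 * M) and the interaction costs at most \<beta> * (b -
    a) / 2; the smallness assumption makes the difference positive.\<close>
  define \<kappa> where "\<kappa> = (1 - M * \<beta> * (b - a)) / (2 * M)"
  have "\<kappa> > 0" using small \<open>M > 0\<close> by (simp add: \<kappa>_def)
  \<comment> \<open>This quantitative gap gives minimality by dropping the square and uniqueness by
    forcing it to vanish.\<close>
  have gap: "free_energy \<beta> W \<rho>\<^sub>0 + ereal (\<kappa> * (LINT x|?T. \<bar>\<rho> x - M\<bar>)\<^sup>2) \<le> free_energy \<beta> W \<rho>"
    if "\<rho> \<in> densities M" for \<rho>
  proof -
    define N where "N = (LINT x|?T. \<bar>\<rho> x - M\<bar>)"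
    have int: "integrable ?T \<rho>" and nonneg: "AE x in ?T. 0 \<le> \<rho> x"
      and mass: "(LINT x|?T. \<rho> x) = M" and ent: "integrable ?T (\<lambda>x. \<rho> x * ln (\<rho> x))"
      using that by (auto simp: densities_def finite_entropy_def)
    have "N\<^sup>2 \<le> 2 * M * ((LINT x|?T. \<rho> x * ln (\<rho> x)) - M * ln M)"
      unfolding N_def by (rule T.Pinsker_inequality[OF \<open>M > 0\<close> int nonneg mass ent])
    then have "N\<^sup>2 / (2 * M) \<le> (LINT x|?T. \<rho> x * ln (\<rho> x)) - M * ln M"
      using \<open>M > 0\<close> by (simp add: field_simps)
    moreover have "\<beta> * ((LINT x|?T. \<rho> x * torus_conv W \<rho> x) - M\<^sup>2 * w) \<le> \<beta> * ((b - a) / 2 * N\<^sup>2)"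
      using abs_le_D1[OF interaction[OF int mass]] \<open>\<beta> > 0\<close>
      by (intro mult_left_mono) (simp_all add: N_def w_def)
    moreover have "\<kappa> * N\<^sup>2 = N\<^sup>2 / (2 * M) - \<beta> * ((b - a) / 2 * N\<^sup>2)"
      using \<open>M > 0\<close> by (simp add: \<kappa>_def field_simps)
    moreover have "(LINT x|?T. \<rho> x * (ln (\<rho> x) - 1)) = (LINT x|?T. \<rho> x * ln (\<rho> x)) - M"
      using int ent mass by (simp add: right_diff_distrib)
    moreover have "free_energy \<beta> W \<rho> = ereal ((LINT x|?T. \<rho> x * (ln (\<rho> x) - 1))
        - \<beta> * (LINT x|?T. \<rho> x * torus_conv W \<rho> x))"
      using ent by (simp add: free_energy_def finite_entropy_def)
    ultimately show ?thesis
      unfolding energy0 N_def[symmetric] by (simp add: right_diff_distrib)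
  qed
  have "free_energy \<beta> W \<rho>\<^sub>0 \<le> free_energy \<beta> W \<rho>" if "\<rho> \<in> densities M" for \<rho>
  proof -
    have "free_energy \<beta> W \<rho>\<^sub>0 \<le> free_energy \<beta> W \<rho>\<^sub>0 + ereal (\<kappa> * (LINT x|?T. \<bar>\<rho> x - M\<bar>)\<^sup>2)"
      using \<open>\<kappa> > 0\<close> by (simp add: energy0)
    with gap[OF that] show ?thesis by (rule order_trans[rotated])
  qed
  moreover have "AE x in ?T. \<rho> x = \<rho>\<^sub>0 x"
    if \<rho>: "\<rho> \<in> densities M" and "\<forall>\<sigma> \<in> densities M. free_energy \<beta> W \<rho> \<le> free_energy \<beta> W \<sigma>" for \<rho>
  proof -
    \<comment> \<open>A minimizer \<rho> is compared with the constant density as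
      competitor.\<close>
    have "free_energy \<beta> W \<rho>\<^sub>0 + ereal (\<kappa> * (LINT x|?T. \<bar>\<rho> x - M\<bar>)\<^sup>2) \<le> free_energy \<beta> W \<rho>\<^sub>0"
      using gap[OF \<rho>] that(2) mem order_trans by blast
    \<comment> \<open>The energy of the constant density is a finite real, so it cancels in the
      extended reals.\<close>
    then have "\<kappa> * (LINT x|?T. \<bar>\<rho> x - M\<bar>)\<^sup>2 \<le> 0" by (simp add: energy0)
    with \<open>\<kappa> > 0\<close> have "(LINT x|?T. \<bar>\<rho> x - M\<bar>) = 0" by (simp add: mult_le_0_iff)
    moreover have "integrable ?T (\<lambda>x. \<bar>\<rho> x - M\<bar>)" using \<rho> by (simp add: densities_def)
    ultimately have "AE x in ?T. \<bar>\<rho> x - M\<bar> = 0"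
      by (subst (asm) integral_nonneg_eq_0_iff_AE) auto
    then show ?thesis by (simp add: \<rho>\<^sub>0)
  qed
  ultimately show ?thesis using mem by blast
qed

end
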